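(* Let $(G,p,L)$ be a non-flat $\mathbb{Z}^d$-tensegrity with volume equal to one. Suppose that there are a positive number $\lambda$ and a $\lambda$-equilibrium stress $\omega$ of $(G,p,L)$ such that $\dim\ker\mathcal{L}_{\mathbb{Z}^d}(G,\omega)=1$ and $\mathcal{L}_{\mathbb{Z}^d}(G,\omega)$ is positive semidefinite. Then $(G,p,L)$ is globally rigid over all tensegrities with volume at least one; that is, every $\mathbb{Z}^d$-tensegrity $(G,p',L')$ with $|\det L'|\ge 1$ that is dominated by $(G,p,L)$ is congruent to $(G,p,L)$.
   Context: Fix an integer $d\ge 1$. A $\mathbb{Z}^d$-gain graph $G=(V,E)$ consists of a finite nonempty vertex set $V$ and a finite set $E$ of edges, where an edge is an equivalence class of triples $(u,v,\gamma)\in V\times V\times\mathbb{Z}^d$ under the identification $(u,v,\gamma)\sim(v,u,-\gamma)$, and triples $(u,u,0)$ are not allowed. The edge is a loop if $u=v$. One representative of each edge is fixed; the notions below do not depend on this choice. A $\mathbb{Z}^d$-framework is a triple $(G,p,L)$ with $p:V\to\mathbb{R}^d$ and $L\in\mathbb{R}^{d\times d}$ (the lattice). It is non-flat if $L$ is nonsingular; its volume is $|\det L|$. Two frameworks $(G,p,L)$, $(G,q,L')$ are congruent if there are an orthogonal $d\times d$ matrix $M$ and $x\in\mathbb{R}^d$ with $q(v)=Mp(v)+x$ for all $v\in V$ and $L'=ML$. A $\mathbb{Z}^d$-tensegrity is a $\mathbb{Z}^d$-framework together with a partition $E=E_0\sqcup E_+\sqcup E_-$ (bars, cables, struts). $(G,p,L)$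 dominates $(G,p',L')$ (same partition) if, for every $(u,v,\gamma)\in E$, $\|p(v)+L\gamma-p(u)\|$ is equal to (for bars), $\ge$ (for cables), $\le$ (for struts) $\|p'(v)+L'\gamma-p'(u)\|$. For $\lambda\in\mathbb{R}$, a $\lambda$-equilibrium stress of a non-flat tensegrity $(G,p,L)$ is $\omega:E\to\mathbb{R}$ that is proper, i.e. $\omega(e)\ge0$ for $e\in E_+$ and $\omega(e)\le0$ for $e\in E_-$, and satisfies: for each $x\in V$, $\sum\omega(e)(p(x)+L\gamma-p(u))=\mathbf{0}$, the sum being over non-loop edges $e$ at $x$ written as $e=(u,x,\gamma)$; and $\sum_{e=(u,v,\gamma)\in E}\omega(e)(p(v)+L\gamma-p(u))\gamma^\top=\lambda L^{-\top}$, where $L^{-\top}=(L^{-1})^\top$. $I_{\mathbb{Z}^d}(G)$ is the $|E|\times(|V|+d)$ matrix whose row for $e=(u,v,\gamma)$ has $-1$ in column $u$, $+1$ in column $v$, $0$ in the other vertex columns (all vertex columns $0$ if $e$ is a loop), and $\gamma^\top$ in the last $d$ columns. $\mathcal{L}_{\mathbb{Z}^d}(G,\omega)=I_{\mathbb{Z}^d}(G)^\top\,\mathrm{diag}(\omega)\,I_{\mathbb{Z}^d}(G)$. *)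

theory Defs
  imports "HOL-Analysis.Analysis"
begin

text \<open>
  The vertex set is the whole of a finite type \<open>'v\<close> (finite and nonempty), and the dimension
  \<open>d \<ge> 1\<close> is \<open>CARD('d)\<close>.
  An edge is given by its fixed representative, a triple \<open>(u, v, \<gamma>)\<close>.
\<close>

type_synonym ('v, 'd) gain_edge = "'v \<times> 'v \<times> (int^'d)"

definition tail :: "('v, 'd::finite) gain_edge \<Rightarrow> 'v" where
  "tail e = fst e"

definition head :: "('v, 'd::finite) gain_edge \<Rightarrow> 'v" where
  "head e = fst (snd e)"

definition gain :: "('v, 'd::finite) gain_edge \<Rightarrow> int^'d" where
  "gain e = snd (snd e)"

definition reverse :: "('v, 'd::finite) gain_edge \<Rightarrow> ('v, 'd) gain_edge" where
  "reverse e = (head e, tail e, - gain e)"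

text \<open>
  The last condition says that distinct members of \<open>E\<close> represent distinct classes of triples
  modulo \<open>(u, v, \<gamma>) \<sim> (v, u, -\<gamma>)\<close>.
\<close>

definition gain_graph :: "('v::finite, 'd::finite) gain_edge set \<Rightarrow> bool" where
  "gain_graph E \<longleftrightarrow>
     finite E \<and> (\<forall>u. (u, u, 0) \<notin> E) \<and> (\<forall>e\<in>E. \<forall>e'\<in>E. e' = reverse e \<longrightarrow> e' = e)"

definition edge_partition ::
    "('v, 'd::finite) gain_edge set \<Rightarrow> ('v, 'd) gain_edge set \<Rightarrow> ('v, 'd) gain_edge set \<Rightarrow>
     ('v, 'd) gain_edge set \<Rightarrow> bool" where
  "edge_partition E bars cables struts \<longleftrightarrow>
     E = bars \<union> cables \<union> struts \<and>
     bars \<inter> cables = {} \<and> bars \<inter> struts = {} \<and> cables \<inter> struts = {}"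

definition real_gain :: "('v, 'd::finite) gain_edge \<Rightarrow> real^'d" where
  "real_gain e = (\<chi> i. of_int (gain e $ i))"

definition edge_vec :: "('v \<Rightarrow> real^'d) \<Rightarrow> real^'d^'d \<Rightarrow> ('v, 'd::finite) gain_edge \<Rightarrow> real^'d" where
  "edge_vec p L e = p (head e) + L *v real_gain e - p (tail e)"

definition lattice_volume :: "real^'d^'d \<Rightarrow> real" where
  "lattice_volume L = \<bar>det L\<bar>"

definition congruent_frameworks ::
    "('v \<Rightarrow> real^'d) \<Rightarrow> real^'d^'d \<Rightarrow> ('v \<Rightarrow> real^'d) \<Rightarrow> real^'d^'d \<Rightarrow> bool" where
  "congruent_frameworks p L q L' \<longleftrightarrow>
     (\<exists>M x. orthogonal_matrix M \<and> (\<forall>v. q v = M *v p v + x) \<and> L' = M ** L)"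

definition dominates ::
    "('v, 'd::finite) gain_edge set \<Rightarrow> ('v, 'd) gain_edge set \<Rightarrow> ('v, 'd) gain_edge set \<Rightarrow>
     ('v \<Rightarrow> real^'d) \<Rightarrow> real^'d^'d \<Rightarrow> ('v \<Rightarrow> real^'d) \<Rightarrow> real^'d^'d \<Rightarrow> bool" where
  "dominates bars cables struts p L p' L' \<longleftrightarrow>
     (\<forall>e\<in>bars. norm (edge_vec p L e) = norm (edge_vec p' L' e)) \<and>
     (\<forall>e\<in>cables. norm (edge_vec p L e) \<ge> norm (edge_vec p' L' e)) \<and>
     (\<forall>e\<in>struts. norm (edge_vec p L e) \<le> norm (edge_vec p' L' e))"

definition proper_stress ::
    "('v, 'd::finite) gain_edge set \<Rightarrow> ('v, 'd) gain_edge set \<Rightarrow>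
     (('v, 'd) gain_edge \<Rightarrow> real) \<Rightarrow> bool" where
  "proper_stress cables struts \<omega> \<longleftrightarrow> (\<forall>e\<in>cables. \<omega> e \<ge> 0) \<and> (\<forall>e\<in>struts. \<omega> e \<le> 0)"

text \<open>The matrix \<open>a b\<^sup>T\<close>.\<close>

definition outer_product :: "real^'n \<Rightarrow> real^'m \<Rightarrow> real^'m^'n" where
  "outer_product a b = (\<chi> i j. a $ i * b $ j)"

text \<open>
  In the equilibrium condition at \<open>x\<close>, the first sum runs over the non-loop edges whose fixed
  representative already has the form \<open>(u, x, \<gamma>)\<close>, the second one over those that have to be
  reversed to be written in this form.
\<close>

definition equilibrium_stress ::
    "('v, 'd::finite) gain_edge set \<Rightarrow> ('v, 'd) gain_edge set \<Rightarrow> ('v, 'd) gain_edge set \<Rightarrow>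
     ('v \<Rightarrow> real^'d) \<Rightarrow> real^'d^'d \<Rightarrow> real \<Rightarrow> (('v, 'd) gain_edge \<Rightarrow> real) \<Rightarrow> bool" where
  "equilibrium_stress E cables struts p L l \<omega> \<longleftrightarrow>
     proper_stress cables struts \<omega> \<and>
     (\<forall>x. (\<Sum>e | e \<in> E \<and> tail e \<noteq> head e \<and> head e = x. \<omega> e *\<^sub>R edge_vec p L e) +
          (\<Sum>e | e \<in> E \<and> tail e \<noteq> head e \<and> tail e = x. \<omega> e *\<^sub>R edge_vec p L (reverse e)) = 0) \<and>
     (\<Sum>e\<in>E. \<omega> e *\<^sub>R outer_product (edge_vec p L e) (real_gain e)) =
       l *\<^sub>R transpose (matrix_inv L)"

text \<open>
  The row of the incidence matrix for the edge \<open>e\<close>. The columns are indexed by the sum type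
  \<open>'v + 'd\<close>. For a loop the two contributions in the vertex columns cancel.
\<close>

definition incidence_row :: "('v::finite, 'd::finite) gain_edge \<Rightarrow> real^('v + 'd)" where
  "incidence_row e =
     (\<chi> k. case k of
        Inl x \<Rightarrow> (if x = head e then 1 else 0) - (if x = tail e then 1 else 0)
      | Inr i \<Rightarrow> real_gain e $ i)"

text \<open>
  The entries of \<open>I\<^sup>T diag(\<omega>) I\<close>, where the rows of \<open>I\<close> are indexed by the
  finite set \<open>E\<close>.
\<close>

definition laplacian ::
    "('v::finite, 'd::finite) gain_edge set \<Rightarrow> (('v, 'd) gain_edge \<Rightarrow> real) \<Rightarrow>
     real^('v + 'd)^('v + 'd)" where
  "laplacian E \<omega> = (\<chi> k m. \<Sum>e\<in>E. incidence_row e $ k * \<omega> e * incidence_row e $ m)"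

definition matrix_kernel :: "real^'n^'m \<Rightarrow> (real^'n) set" where
  "matrix_kernel A = {x. A *v x = 0}"

definition positive_semidefinite :: "real^'n^'n \<Rightarrow> bool" where
  "positive_semidefinite A \<longleftrightarrow> transpose A = A \<and> (\<forall>x. x \<bullet> (A *v x) \<ge> 0)"

text \<open>
  For the tensegrity \<open>(G, p, L)\<close> with the given bars, cables and struts: rigidity among the
  tensegrities on the same graph and partition with volume at least \<open>c\<close>.
\<close>

definition globally_rigid_volume_ge ::
    "real \<Rightarrow> ('v, 'd::finite) gain_edge set \<Rightarrow> ('v, 'd) gain_edge set \<Rightarrow> ('v, 'd) gain_edge set \<Rightarrow>
     ('v \<Rightarrow> real^'d) \<Rightarrow> real^'d^'d \<Rightarrow> bool" where
  "globally_rigid_volume_ge c bars cables struts p L \<longleftrightarrow>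
     (\<forall>p' L'. lattice_volume L' \<ge> c \<and> dominates bars cables struts p L p' L' \<longrightarrow>
        congruent_frameworks p L p' L')"

end

theory Submission
  imports Defs
begin

text \<open>
  The stress energy \<open>\<Sum>e. \<omega> e |edge e|\<^sup>2\<close> is \<open>l * d\<close> at \<open>(p, L)\<close> and does not increase when passing
  to a dominated \<open>(p', L')\<close>. Put \<open>A = L' L\<^sup>-\<^sup>1\<close>. The equilibrium conditions turn the energy of the
  difference \<open>(p' - A p, L' - A L) = (p' - A p, 0)\<close> into the energy of \<open>(p', L')\<close> minus
  \<open>l |A|\<^sup>2\<close> (Frobenius norm). It is nonnegative, so \<open>|A|\<^sup>2 \<le> d\<close>, whereas
  \<open>|det A| \<ge> 1\<close>; this forces \<open>A\<close> to be orthogonal, and then \<open>p' - A p\<close> has energy zero, so it lies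
  in the kernel of the Laplacian, that is, it is constant.
\<close>

lemma
  assumes "invertible A"
  shows matrix_inv_right: "A ** matrix_inv A = mat 1"
    and matrix_inv_left: "matrix_inv A ** A = mat 1"
proof -
  have "A ** matrix_inv A = mat 1 \<and> matrix_inv A ** A = mat 1"
    using assms unfolding invertible_def matrix_inv_def by (rule someI_ex)
  thus "A ** matrix_inv A = mat 1" "matrix_inv A ** A = mat 1" by auto
qed

section \<open>Matrices of determinant at least one and minimal Frobenius norm\<close>

lemma inner_matrix_rows:
  fixes A B :: "real^'n^'m"
  shows "A \<bullet> B = (\<Sum>i\<in>UNIV. row i A \<bullet> row i B)"
  by (simp add: inner_vec_def row_def)

lemma inner_transpose_eq_trace:
  fixes X :: "real^'n^'n"
  shows "X \<bullet> transpose Y = trace (X ** Y)"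
  by (simp add: inner_vec_def transpose_def trace_def matrix_matrix_mult_def)

lemma inner_matrix_change_row:
  fixes A :: "real^'n^'m"
  shows "(\<chi> k. if k = i then r else row k A) \<bullet> (\<chi> k. if k = i then r else row k A)
       = A \<bullet> A - row i A \<bullet> row i A + r \<bullet> r"
proof -
  have row: "row k (\<chi> k. if k = i then r else row k A) = (if k = i then r else row k A)" for k
    by (simp add: row_def vec_eq_iff)
  have "(\<Sum>k\<in>UNIV. (if k = i then r else row k A) \<bullet> (if k = i then r else row k A))
      = r \<bullet> r + (\<Sum>k\<in>UNIV-{i}. row k A \<bullet> row k A)"
    by (subst sum.remove[of _ i]) (auto intro!: sum.cong)
  moreover have "(\<Sum>k\<in>UNIV. row k A \<bullet> row k A)
      = row i A \<bullet> row i A + (\<Sum>k\<in>UNIV-{i}. row k A \<bullet> row k A)"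
    by (subst sum.remove[of _ i]) auto
  ultimately show ?thesis
    unfolding inner_matrix_rows row by simp
qed

lemma det_scale_row:
  fixes A :: "real^'n^'n"
  shows "det (\<chi> k. if k = i then c *\<^sub>R row i A else row k A) = c * det A"
proof -
  have "det (\<chi> k. if k = i then c *s row i A else row k A)
      = c * det (\<chi> k. if k = i then row i A else row k A)"
    by (rule det_row_mul)
  moreover have "(\<chi> k. if k = i then row i A else row k A) = A"
    by (simp add: vec_eq_iff row_def)
  ultimately show ?thesis by (simp add: scalar_mult_eq_scaleR cong: if_cong)
qed

text \<open>This is a Gram-Schmidt step: subtracting from row \<open>i\<close> its projection onto
  row \<open>j\<close> keeps the determinant and lowers the squared norm by
  \<open>a\<^sup>2 / b\<close>, which minimality forbids unless \<open>a = 0\<close>.\<close>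

lemma minimal_norm_rows_orthogonal:
  fixes A :: "real^'n^'n"
  assumes det: "\<bar>det A\<bar> \<ge> 1"
    and minimal: "\<And>B::real^'n^'n. \<bar>det B\<bar> \<ge> 1 \<Longrightarrow> A \<bullet> A \<le> B \<bullet> B"
    and "i \<noteq> j"
  shows "row i A \<bullet> row j A = 0"
proof (rule ccontr)
  assume nz: "row i A \<bullet> row j A \<noteq> 0"
  define a b where "a = row i A \<bullet> row j A" and "b = row j A \<bullet> row j A"
  define B where "B = (\<chi> k. if k = i then row i A + (- a / b) *\<^sub>R row j A else row k A)"
  have "b > 0" using nz by (auto simp: b_def)
  have "det B = det A"
    using det_row_operation[OF \<open>i \<noteq> j\<close>, of A "- a / b"]
    by (simp add: B_def scalar_mult_eq_scaleR cong: if_cong)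
  hence "A \<bullet> A \<le> B \<bullet> B" using minimal det by simp
  also have "B \<bullet> B = A \<bullet> A - a\<^sup>2 / b"
    unfolding B_def inner_matrix_change_row
    using \<open>b > 0\<close>
    by (simp add: inner_simps inner_commute[of "row j A" "row i A"]
        flip: a_def b_def) (simp add: field_simps power2_eq_square)
  finally show False using nz \<open>b > 0\<close> by (simp add: a_def field_simps)
qed

text \<open>Scaling one row by \<open>t\<close> and another one by \<open>1 / t\<close> preserves the determinant.\<close>

lemma minimal_norm_rows_same_length:
  fixes A :: "real^'n^'n"
  assumes det: "\<bar>det A\<bar> \<ge> 1"
    and minimal: "\<And>B::real^'n^'n. \<bar>det B\<bar> \<ge> 1 \<Longrightarrow> A \<bullet> A \<le> B \<bullet> B"
  shows "norm (row i A) = norm (row j A)"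
proof (cases "i = j")
  case False
  define a b where "a = norm (row i A)" and "b = norm (row j A)"
  have pos: "a > 0" "b > 0"
    using det det_zero_row(2)[of i A] det_zero_row(2)[of j A] by (auto simp: a_def b_def)
  \<comment> \<open>This value gives both rescaled rows the squared length \<open>a * b\<close>, so
    minimality yields \<open>a\<^sup>2 + b\<^sup>2 \<le> 2 * a * b\<close>.\<close>
  define t where "t = sqrt (b / a)"
  have t: "t > 0" "t\<^sup>2 = b / a" using pos by (auto simp: t_def)
  define C where "C = (\<chi> k. if k = i then t *\<^sub>R row i A else row k A)"
  define B where "B = (\<chi> k. if k = j then (1 / t) *\<^sub>R row j C else row k C)"
  have row_j: "row j C = row j A" using False by (simp add: C_def row_def vec_eq_iff)
  have "det B = det A"
    unfolding B_def det_scale_row unfolding C_def det_scale_row using t by simp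
  hence "A \<bullet> A \<le> B \<bullet> B" using minimal det by simp
  also have "B \<bullet> B = C \<bullet> C - b\<^sup>2 + b\<^sup>2 / t\<^sup>2"
    unfolding B_def inner_matrix_change_row row_j
    by (simp add: b_def power2_norm_eq_inner power_divide) (simp add: power2_eq_square)
  also have "C \<bullet> C = A \<bullet> A - a\<^sup>2 + t\<^sup>2 * a\<^sup>2"
    unfolding C_def inner_matrix_change_row
    by (simp add: a_def power2_norm_eq_inner) (simp add: power2_eq_square)
  also have "b\<^sup>2 / t\<^sup>2 = a * b" using pos unfolding t by (simp add: power2_eq_square)
  also have "t\<^sup>2 * a\<^sup>2 = a * b" using pos unfolding t by (simp add: power2_eq_square)
  finally have "(a - b)\<^sup>2 \<le> 0" by (simp add: power2_eq_square algebra_simps)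
  thus ?thesis by (simp add: a_def b_def)
qed simp

text \<open>By the two preceding lemmas, \<open>A ** transpose A\<close> is \<open>c\<close> times
  the identity, where \<open>c\<close> is the common squared row length. Comparing norms with the
  identity matrix gives \<open>c \<le> 1\<close>, and the determinant gives
  \<open>c ^ CARD('n) \<ge> 1\<close>.\<close>

lemma minimal_norm_orthogonal:
  fixes A :: "real^'n^'n"
  assumes det: "\<bar>det A\<bar> \<ge> 1"
    and minimal: "\<And>B::real^'n^'n. \<bar>det B\<bar> \<ge> 1 \<Longrightarrow> A \<bullet> A \<le> B \<bullet> B"
  shows "orthogonal_matrix A" and "A \<bullet> A = real CARD('n)"
proof -
  fix k :: 'n
  define c where "c = row k A \<bullet> row k A"
  have c: "row i A \<bullet> row i A = c" for i
    using minimal_norm_rows_same_length[OF assms, of i k]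
    by (simp add: c_def flip: power2_norm_eq_inner)
  have AAt: "A ** transpose A = c *\<^sub>R mat 1"
    using minimal_norm_rows_orthogonal[OF assms] c
    by (simp add: vec_eq_iff matrix_mult_transpose_dot_row mat_def)
  have norm_A: "A \<bullet> A = real CARD('n) * c"
    by (simp add: inner_matrix_rows c)
  have "real CARD('n) * c = A \<bullet> A" by (simp add: norm_A)
  also have "\<dots> \<le> (mat 1 :: real^'n^'n) \<bullet> mat 1"
    by (rule minimal) simp
  also have "\<dots> = real CARD('n)"
    using inner_transpose_eq_trace[of "mat 1" "mat 1 :: real^'n^'n"] by (simp add: trace_I)
  finally have "c \<le> 1" by simp
  have "(det A)\<^sup>2 = det (A ** transpose A)"
    by (simp add: det_mul power2_eq_square)
  also have "\<dots> = c ^ CARD('n)"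
    unfolding AAt by (subst det_diagonal) (simp_all add: mat_def)
  finally have "c ^ CARD('n) \<ge> 1"
    using det by (metis abs_ge_zero one_le_power power2_abs)
  moreover have "c ^ CARD('n) < 1" if "c < 1"
    using that by (simp add: power_less_one_iff c_def)
  ultimately have "c = 1" using \<open>c \<le> 1\<close> by force
  show "A \<bullet> A = real CARD('n)" using norm_A \<open>c = 1\<close> by simp
  show "orthogonal_matrix A"
    using AAt \<open>c = 1\<close> by (simp add: orthogonal_matrix matrix_left_right_inverse)
qed

text \<open>The determinant is continuous, so the admissible matrices form a nonempty closed set,
  which has a point nearest to the origin.\<close>

lemma ex_minimal_norm_det_ge_1:
  obtains A :: "real^'n^'n"
  where "\<bar>det A\<bar> \<ge> 1" "\<And>B::real^'n^'n. \<bar>det B\<bar> \<ge> 1 \<Longrightarrow> A \<bullet> A \<le> B \<bullet> B"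
proof -
  define S where "S = {A::real^'n^'n. \<bar>det A\<bar> \<ge> 1}"
  have "closed S"
    unfolding S_def det_def by (intro closed_Collect_le continuous_intros)
  moreover have "mat 1 \<in> S" by (simp add: S_def)
  ultimately obtain A where "A \<in> S" "\<And>B. B \<in> S \<Longrightarrow> dist 0 A \<le> dist 0 B"
    using distance_attains_inf[of S 0] by blast
  thus ?thesis
    by (intro that[of A]) (auto simp: S_def norm_le)
qed

text \<open>The minimal squared norm is exactly the dimension, so the bound makes \<open>A\<close>
  itself a minimizer. This replaces Hadamard's inequality combined with the one between arithmetic
  and geometric means.\<close>

lemma det_ge_1_norm_le_imp_orthogonal:
  fixes A :: "real^'n^'n"
  assumes "\<bar>det A\<bar> \<ge> 1" and "A \<bullet> A \<le> real CARD('n)"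
  shows "orthogonal_matrix A" and "A \<bullet> A = real CARD('n)"
proof -
  obtain M :: "real^'n^'n" where
    M: "\<bar>det M\<bar> \<ge> 1" "\<And>B::real^'n^'n. \<bar>det B\<bar> \<ge> 1 \<Longrightarrow> M \<bullet> M \<le> B \<bullet> B"
    using ex_minimal_norm_det_ge_1 by blast
  have "A \<bullet> A \<le> B \<bullet> B" if "\<bar>det B\<bar> \<ge> 1" for B :: "real^'n^'n"
    using assms(2) M(2)[OF that] minimal_norm_orthogonal(2)[OF M] by simp
  from minimal_norm_orthogonal[OF assms(1) this]
  show "orthogonal_matrix A" "A \<bullet> A = real CARD('n)" by auto
qed

section \<open>Positive semidefinite matrices\<close>

text \<open>Moving from \<open>z\<close> by \<open>t *\<^sub>R w\<close> with
  \<open>w = A *v z\<close> gives the form the value \<open>2 * t * a + t\<^sup>2 * b\<close>. Its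
  linear term would make it negative for small negative \<open>t\<close> if \<open>a\<close> were
  positive.\<close>

lemma positive_semidefinite_null_vector:
  assumes psd: "positive_semidefinite A" and null: "z \<bullet> (A *v z) = 0"
  shows "A *v z = 0"
proof -
  define w where "w = A *v z"
  define a b where "a = w \<bullet> w" and "b = w \<bullet> (A *v w)"
  have "b \<ge> 0" using psd by (simp add: positive_semidefinite_def b_def)
  have sym: "z \<bullet> (A *v w) = a"
    using psd dot_lmul_matrix[of z A w]
    by (simp add: positive_semidefinite_def a_def w_def transpose_matrix_vector[symmetric])
  \<comment> \<open>Dividing by \<open>b + 1\<close> instead of \<open>b\<close> covers the case
    \<open>b = 0\<close> as well.\<close>
  define t where "t = - a / (b + 1)"
  have "0 \<le> (z + t *\<^sub>R w) \<bullet> (A *v (z + t *\<^sub>R w))"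
    using psd by (simp add: positive_semidefinite_def)
  also have "\<dots> = 2 * t * a + t\<^sup>2 * b"
    using null sym
    by (simp add: matrix_vector_right_distrib matrix_vector_mult_scaleR inner_simps a_def b_def
        power2_eq_square distrib_left flip: w_def)
  also have a: "a = - t * (b + 1)" using \<open>b \<ge> 0\<close> by (simp add: t_def field_simps)
  also have "2 * t * (- t * (b + 1)) + t\<^sup>2 * b = - (t\<^sup>2 * (b + 2))"
    by (simp add: algebra_simps power2_eq_square)
  finally have "t = 0" using \<open>b \<ge> 0\<close> by (simp add: mult_le_0_iff)
  hence "a = 0" using a by simp
  thus ?thesis by (simp add: a_def w_def)
qed

section \<open>Stress energy\<close>

text \<open>Taking one coordinate direction at a time turns a framework into vectors on which the
  incidence matrix acts. The energy thus splits into one Laplacian form per direction.\<close>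

definition coordinate :: "('v::finite \<Rightarrow> real^'d::finite) \<Rightarrow> real^'d^'d \<Rightarrow> 'd \<Rightarrow> real^('v + 'd)" where
  "coordinate p L i = (\<chi> k. case k of Inl x \<Rightarrow> p x $ i | Inr j \<Rightarrow> L $ i $ j)"

lemma sum_UNIV_Plus:
  "(\<Sum>k\<in>(UNIV::('a::finite + 'b::finite) set). f k) =
     (\<Sum>x\<in>UNIV. f (Inl x)) + (\<Sum>y\<in>UNIV. f (Inr y))"
  by (subst UNIV_Plus_UNIV[symmetric], subst sum.Plus) auto

lemma incidence_row_inner_coordinate:
  "incidence_row e \<bullet> coordinate p L i = edge_vec p L e $ i"
  by (simp add: inner_vec_def sum_UNIV_Plus incidence_row_def coordinate_def edge_vec_def
      left_diff_distrib sum_subtractf if_distrib[of "\<lambda>c. c * _"] matrix_vector_mult_def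
      mult.commute[of "real_gain e $ _"] cong: if_cong)

lemma laplacian_mult_vector:
  "laplacian E \<omega> *v z = (\<Sum>e\<in>E. (\<omega> e * (incidence_row e \<bullet> z)) *\<^sub>R incidence_row e)"
proof -
  have "(laplacian E \<omega> *v z) $ k = (\<Sum>e\<in>E. \<omega> e * (incidence_row e \<bullet> z) * incidence_row e $ k)" for k
    unfolding laplacian_def matrix_vector_mult_def inner_vec_def
    by (simp add: sum_distrib_left sum_distrib_right) (subst sum.swap, simp add: mult_ac)
  thus ?thesis by (simp add: vec_eq_iff)
qed

lemma laplacian_quadratic_form:
  "z \<bullet> (laplacian E \<omega> *v z) = (\<Sum>e\<in>E. \<omega> e * (incidence_row e \<bullet> z)\<^sup>2)"
  by (simp add: laplacian_mult_vector inner_sum_right inner_commute power2_eq_square mult_ac)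

definition stress_energy ::
    "('v, 'd::finite) gain_edge set \<Rightarrow> (('v, 'd) gain_edge \<Rightarrow> real) \<Rightarrow>
     ('v \<Rightarrow> real^'d) \<Rightarrow> real^'d^'d \<Rightarrow> real" where
  "stress_energy E \<omega> p L = (\<Sum>e\<in>E. \<omega> e * (norm (edge_vec p L e))\<^sup>2)"

lemma stress_energy_laplacian:
  "stress_energy E \<omega> p L =
     (\<Sum>i\<in>UNIV. coordinate p L i \<bullet> (laplacian E \<omega> *v coordinate p L i))"
proof -
  have "stress_energy E \<omega> p L = (\<Sum>e\<in>E. \<Sum>i\<in>UNIV. \<omega> e * (edge_vec p L e $ i)\<^sup>2)"
    by (simp add: stress_energy_def power2_norm_eq_inner inner_vec_def sum_distrib_left
        flip: power2_eq_square)
  thus ?thesis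
    by (subst (asm) sum.swap) (simp add: laplacian_quadratic_form incidence_row_inner_coordinate)
qed

lemma stress_energy_nonneg:
  "positive_semidefinite (laplacian E \<omega>) \<Longrightarrow> stress_energy E \<omega> p L \<ge> 0"
  by (simp add: stress_energy_laplacian positive_semidefinite_def sum_nonneg)

lemma stress_energy_zero_imp_kernel:
  assumes "positive_semidefinite (laplacian E \<omega>)" and "stress_energy E \<omega> p L = 0"
  shows "coordinate p L i \<in> matrix_kernel (laplacian E \<omega>)"
proof -
  have "coordinate p L i \<bullet> (laplacian E \<omega> *v coordinate p L i) = 0"
    using assms unfolding stress_energy_laplacian
    by (subst (asm) sum_nonneg_eq_0_iff) (auto simp: positive_semidefinite_def)
  thus ?thesis
    using positive_semidefinite_null_vector[OF assms(1)] by (simp add: matrix_kernel_def)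
qed

text \<open>Translating all vertices while fixing the lattice gives a nonzero kernel vector
  \<open>u\<close>, so a one-dimensional kernel is spanned by it.\<close>

lemma laplacian_kernel_constant:
  fixes E :: "('v::finite, 'd::finite) gain_edge set"
  assumes dim: "dim (matrix_kernel (laplacian E \<omega>)) = 1"
    and q: "coordinate q 0 i \<in> matrix_kernel (laplacian E \<omega>)"
  shows "\<exists>c. \<forall>v. q v $ i = c"
proof -
  define u :: "real^('v + 'd)" where "u = coordinate (\<lambda>_. \<chi> _. 1) 0 i"
  have "incidence_row e \<bullet> u = 0" for e
    by (simp add: u_def incidence_row_inner_coordinate edge_vec_def)
  hence u: "u \<in> matrix_kernel (laplacian E \<omega>)"
    by (simp add: matrix_kernel_def laplacian_mult_vector)
  \<comment> \<open>\<open>undefined\<close> serves as an arbitrary vertex.\<close>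
  have "u $ Inl undefined = 1" by (simp add: u_def coordinate_def)
  hence "u \<noteq> 0" by auto
  hence "span {u} = span (matrix_kernel (laplacian E \<omega>))"
    using u dim by (intro dim_eq_span) auto
  hence "coordinate q 0 i \<in> span {u}" using q span_base by blast
  then obtain c where c: "coordinate q 0 i = c *\<^sub>R u" by (auto simp: span_singleton)
  have "q v $ i = c" for v
    using arg_cong[OF c, of "\<lambda>z. z $ Inl v"] by (simp add: u_def coordinate_def)
  thus ?thesis by blast
qed

text \<open>The signs of a proper stress match the directions of the length inequalities, so the
  comparison holds edge by edge.\<close>

lemma stress_energy_dominates:
  assumes "edge_partition E bars cables struts"
    and "proper_stress cables struts \<omega>" "dominates bars cables struts p L p' L'"
  shows "stress_energy E \<omega> p' L' \<le> stress_energy E \<omega> p L"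
  unfolding stress_energy_def
proof (rule sum_mono)
  fix e assume "e \<in> E"
  then consider "e \<in> bars" | "e \<in> cables" | "e \<in> struts"
    using assms(1) by (auto simp: edge_partition_def)
  thus "\<omega> e * (norm (edge_vec p' L' e))\<^sup>2 \<le> \<omega> e * (norm (edge_vec p L e))\<^sup>2"
  proof cases
    case 1
    thus ?thesis using assms(3) by (simp add: dominates_def)
  next
    case 2
    thus ?thesis using assms(2,3)
      by (auto simp: dominates_def proper_stress_def intro!: mult_left_mono power_mono)
  next
    case 3
    thus ?thesis using assms(2,3)
      by (auto simp: dominates_def proper_stress_def intro!: mult_left_mono_neg power_mono)
  qed
qed

lemma edge_vec_reverse: "edge_vec p L (reverse e) = - edge_vec p L e"
proof -
  have "real_gain (reverse e) = - real_gain e"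
    by (simp add: real_gain_def reverse_def gain_def vec_eq_iff)
  thus ?thesis
    using matrix_vector_mult_scaleR[of L "-1" "real_gain e"]
    by (simp add: edge_vec_def) (simp add: reverse_def head_def tail_def)
qed

lemma edge_vec_matrix_mult:
  "edge_vec (\<lambda>v. B *v p v) (B ** L) e = B *v edge_vec p L e"
  by (simp add: edge_vec_def matrix_vector_right_distrib matrix_vector_mult_diff_distrib
      matrix_vector_mul_assoc)

lemma inner_outer_product:
  fixes M :: "real^'n^'m"
  shows "M \<bullet> outer_product a b = a \<bullet> (M *v b)"
  by (simp add: inner_vec_def outer_product_def matrix_vector_mult_def sum_distrib_left mult_ac)

text \<open>This is equilibrium in weak form, tested against an arbitrary displacement
  \<open>(q, M)\<close>. The vertex conditions cancel the contribution of \<open>q\<close>; the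
  lattice condition, paired with \<open>M\<close> in the Frobenius inner product, leaves the
  trace.\<close>

lemma equilibrium_stress_virtual_work:
  fixes E :: "('v::finite, 'd::finite) gain_edge set"
  assumes fin: "finite E" and eq: "equilibrium_stress E cables struts p L l \<omega>"
  shows "(\<Sum>e\<in>E. \<omega> e * (edge_vec q M e \<bullet> edge_vec p L e)) = l * trace (M ** matrix_inv L)"
proof -
  define f where "f e = \<omega> e *\<^sub>R edge_vec p L e" for e
  define N where "N = {e\<in>E. tail e \<noteq> head e}"
  have "finite N" using fin by (simp add: N_def)
  have group: "(\<Sum>e\<in>N. q (h e) \<bullet> f e) = (\<Sum>x\<in>UNIV. q x \<bullet> (\<Sum>e | e \<in> N \<and> h e = x. f e))"
    for h :: "_ \<Rightarrow> 'v"
  proof -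
    have "(\<Sum>e\<in>N. q (h e) \<bullet> f e) = (\<Sum>x\<in>UNIV. \<Sum>e | e \<in> N \<and> h e = x. q (h e) \<bullet> f e)"
      using \<open>finite N\<close> by (intro sum.group[symmetric]) auto
    thus ?thesis by (simp add: inner_sum_right)
  qed
  \<comment> \<open>Reversing an edge negates its vector, so the second sum of the vertex condition
    enters with a minus sign.\<close>
  have balance: "(\<Sum>e | e \<in> N \<and> head e = x. f e) - (\<Sum>e | e \<in> N \<and> tail e = x. f e) = 0" for x
    using eq unfolding equilibrium_stress_def
    by (simp add: N_def f_def edge_vec_reverse sum_negf conj_assoc)
  \<comment> \<open>Loops contribute zero here, which matches their absence from the vertex
    conditions.\<close>
  have "(\<Sum>e\<in>E. (q (head e) - q (tail e)) \<bullet> f e) = (\<Sum>e\<in>N. (q (head e) - q (tail e)) \<bullet> f e)"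
    using fin by (intro sum.mono_neutral_right) (auto simp: N_def)
  also have "\<dots> = (\<Sum>x\<in>UNIV. q x \<bullet>
      ((\<Sum>e | e \<in> N \<and> head e = x. f e) - (\<Sum>e | e \<in> N \<and> tail e = x. f e)))"
    by (simp add: inner_diff_left inner_diff_right sum_subtractf group)
  also have "\<dots> = 0" by (simp only: balance) simp
  finally have positions: "(\<Sum>e\<in>E. (q (head e) - q (tail e)) \<bullet> f e) = 0" .
  have "(\<Sum>e\<in>E. (M *v real_gain e) \<bullet> f e)
      = M \<bullet> (\<Sum>e\<in>E. \<omega> e *\<^sub>R outer_product (edge_vec p L e) (real_gain e))"
    by (simp add: inner_sum_right inner_outer_product f_def inner_commute)
  also have "\<dots> = l * trace (M ** matrix_inv L)"
    using eq by (simp add: equilibrium_stress_def inner_transpose_eq_trace)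
  finally have lattice: "(\<Sum>e\<in>E. (M *v real_gain e) \<bullet> f e) = l * trace (M ** matrix_inv L)" .
  have "(\<Sum>e\<in>E. \<omega> e * (edge_vec q M e \<bullet> edge_vec p L e))
      = (\<Sum>e\<in>E. (q (head e) - q (tail e)) \<bullet> f e + (M *v real_gain e) \<bullet> f e)"
    by (intro sum.cong) (simp_all add: f_def edge_vec_def[of q] inner_simps algebra_simps)
  thus ?thesis by (simp add: sum.distrib positions lattice)
qed

text \<open>The framework serves as its own virtual displacement, so the trace is that of the
  identity.\<close>

lemma stress_energy_equilibrium:
  fixes E :: "('v::finite, 'd::finite) gain_edge set"
  assumes "finite E" "equilibrium_stress E cables struts p L l \<omega>" "invertible L"
  shows "stress_energy E \<omega> p L = l * real CARD('d)"
  using equilibrium_stress_virtual_work[OF assms(1,2), of p L] assms(3)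
  by (simp add: stress_energy_def power2_norm_eq_inner matrix_inv_right trace_I)

text \<open>Expanding the square leaves the energy of \<open>(p', A ** L)\<close>, minus twice a
  mixed term, plus the energy of the image of \<open>(p, L)\<close> under \<open>A\<close>. The last
  two sums both equal \<open>l * (A \<bullet> A)\<close>.\<close>

lemma stress_energy_diff:
  fixes E :: "('v::finite, 'd::finite) gain_edge set"
  assumes fin: "finite E" and eq: "equilibrium_stress E cables struts p L l \<omega>"
    and inv: "invertible L"
  shows "stress_energy E \<omega> (\<lambda>v. p' v - A *v p v) 0 = stress_energy E \<omega> p' (A ** L) - l * (A \<bullet> A)"
proof -
  have diff: "edge_vec (\<lambda>v. p' v - A *v p v) 0 e = edge_vec p' (A ** L) e - A *v edge_vec p L e" for e
    by (simp add: edge_vec_def matrix_vector_right_distrib matrix_vector_mult_diff_distrib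
        matrix_vector_mul_assoc algebra_simps)
  have adjoint: "edge_vec q M e \<bullet> (A *v edge_vec p L e)
      = edge_vec (\<lambda>v. transpose A *v q v) (transpose A ** M) e \<bullet> edge_vec p L e" for q M e
    unfolding edge_vec_matrix_mult by (simp add: dot_lmul_matrix)
  \<comment> \<open>Moving \<open>A\<close> across the inner product as its transpose gives a
    virtual work sum. Its value does not depend on \<open>q\<close>, so it applies both to
    \<open>p'\<close> and to the image of \<open>p\<close>.\<close>
  have work: "(\<Sum>e\<in>E. \<omega> e * (edge_vec q (A ** L) e \<bullet> (A *v edge_vec p L e))) = l * (A \<bullet> A)" for q
  proof -
    have "transpose A ** (A ** L) ** matrix_inv L = transpose A ** A"
      using inv by (metis matrix_inv_right matrix_mul_assoc matrix_mul_rid)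
    moreover have "trace (transpose A ** A) = A \<bullet> A"
      by (metis inner_transpose_eq_trace trace_mul_sym transpose_transpose)
    ultimately show ?thesis
      unfolding adjoint equilibrium_stress_virtual_work[OF fin eq] by simp
  qed
  have "stress_energy E \<omega> (\<lambda>v. p' v - A *v p v) 0
      = stress_energy E \<omega> p' (A ** L)
        - 2 * (\<Sum>e\<in>E. \<omega> e * (edge_vec p' (A ** L) e \<bullet> (A *v edge_vec p L e)))
        + (\<Sum>e\<in>E. \<omega> e * (edge_vec (\<lambda>v. A *v p v) (A ** L) e \<bullet> (A *v edge_vec p L e)))"
    unfolding stress_energy_def diff edge_vec_matrix_mult sum_distrib_left
      sum_subtractf[symmetric] sum.distrib[symmetric]
    by (intro sum.cong) (simp_all add: power2_norm_eq_inner inner_simps inner_commute algebra_simps)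
  thus ?thesis by (simp add: work)
qed

theorem theorem8p3:
  fixes E bars cables struts :: "('v::finite, 'd::finite) gain_edge set"
    and p :: "'v \<Rightarrow> real^'d" and L :: "real^'d^'d"
    and l :: real and \<omega> :: "('v, 'd) gain_edge \<Rightarrow> real"
  assumes "gain_graph E"
    and "edge_partition E bars cables struts"
    and "invertible L"
    and "lattice_volume L = 1"
    and "l > 0"
    and "equilibrium_stress E cables struts p L l \<omega>"
    and "dim (matrix_kernel (laplacian E \<omega>)) = 1"
    and "positive_semidefinite (laplacian E \<omega>)"
  shows "globally_rigid_volume_ge 1 bars cables struts p L"
  unfolding globally_rigid_volume_ge_def
proof (intro allI impI, elim conjE)
  fix p' L'
  assume vol: "lattice_volume L' \<ge> 1" and dom: "dominates bars cables struts p L p' L'"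
  have fin: "finite E" using assms(1) by (simp add: gain_graph_def)
  define A where "A = L' ** matrix_inv L"
  have L': "L' = A ** L"
    using assms(3) by (simp add: A_def matrix_inv_left flip: matrix_mul_assoc)
  \<comment> \<open>Since \<open>L\<close> has volume one, \<open>A\<close> and \<open>L'\<close>
    have the same absolute determinant.\<close>
  have det: "\<bar>det A\<bar> \<ge> 1"
    using vol assms(4) by (simp add: L' lattice_volume_def det_mul abs_mult)
  define q where "q v = p' v - A *v p v" for v
  have "stress_energy E \<omega> p' L' \<le> l * real CARD('d)"
    using stress_energy_dominates[OF assms(2) _ dom, of \<omega>] assms(6)
      stress_energy_equilibrium[OF fin assms(6,3)]
    by (simp add: equilibrium_stress_def)
  hence energy: "stress_energy E \<omega> q 0 \<le> l * (real CARD('d) - A \<bullet> A)"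
    using stress_energy_diff[OF fin assms(6,3), of p' A]
    by (simp add: q_def[abs_def] L' right_diff_distrib)
  have nonneg: "stress_energy E \<omega> q 0 \<ge> 0"
    by (rule stress_energy_nonneg[OF assms(8)])
  have "A \<bullet> A \<le> real CARD('d)"
    using order_trans[OF nonneg energy] \<open>l > 0\<close> by (simp add: zero_le_mult_iff)
  note A = det_ge_1_norm_le_imp_orthogonal[OF det this]
  \<comment> \<open>Equality in the norm bound makes the upper bound on the energy zero.\<close>
  have "stress_energy E \<omega> q 0 = 0" using energy nonneg A(2) by simp
  hence "\<forall>i. \<exists>c. \<forall>v. q v $ i = c"
    using laplacian_kernel_constant[OF assms(7)] stress_energy_zero_imp_kernel[OF assms(8)]
    by blast
  then obtain c where "\<And>i v. q v $ i = c i" by metis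
  hence "q v = (\<chi> i. c i)" for v by (simp add: vec_eq_iff)
  hence "p' v = A *v p v + (\<chi> i. c i)" for v
    by (metis q_def add.commute diff_add_cancel)
  thus "congruent_frameworks p L p' L'"
    unfolding congruent_frameworks_def using A(1) L' by blast
qed

end
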